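(* Let $n\ge1$, $a\in L^\infty(D^{III}_n)$ and $b\in L^\infty(\mathscr{S}_n)$. Then the following equivalences hold. \begin{enumerate} \item $a$ is a $\mu^{\mathbb{T}}$-symbol if and only if there exists a measurable function $f$ such that $a(Z)=f\big(\mathrm{tr}\big((I_n-Z\overline{Z})^{-1}\big)\big)$ for almost every $Z\in D^{III}_n$. \item $b$ is a $\mu^{\mathbb{R}_+}$-symbol if and only if there exists a measurable function $f$ such that $b(Z)=f\big(\mathrm{tr}\big(\mathrm{Im}(Z)^{-1}\mathrm{Re}(Z)\big)\big)$ for almost every $Z\in\mathscr{S}_n$. \item $b$ is a $\mu^{\mathrm{Symm}(n,\mathbb{R})}$-symbol if and only if there exists a measurable function $f$ such that $b(Z)=f(\mathrm{Im}(Z))$ for almost every $Z\in\mathscr{S}_n$. \end{enumerate}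
   Context: $D^{III}_n=\{Z\in\mathrm{Symm}(n,\mathbb{C}) : I_n-Z\overline{Z}>0\}$ and $\mathscr{S}_n=\{Z\in\mathrm{Symm}(n,\mathbb{C}) : \mathrm{Im}(Z)>0\}$, with entrywise real and imaginary parts. The moment maps are $\mu^{\mathbb{T}}:D^{III}_n\to\mathbb{R}$, $\mu^{\mathbb{T}}(Z)=-2\,\mathrm{tr}\big((I_n-Z\overline{Z})^{-1}\big)$ (for the $\mathbb{T}$-action $t\cdot Z=t^2Z$); $\mu^{\mathbb{R}_+}:\mathscr{S}_n\to\mathbb{R}$, $\mu^{\mathbb{R}_+}(Z)=-4\,\mathrm{tr}\big(\mathrm{Im}(Z)^{-1}\mathrm{Re}(Z)\big)$ (for the $\mathbb{R}_+$-action $r\cdot Z=r^2Z$); and $\mu^{\mathrm{Symm}(n,\mathbb{R})}:\mathscr{S}_n\to\mathrm{Symm}(n,\mathbb{R})$, $\mu^{\mathrm{Symm}(n,\mathbb{R})}(Z)=-2\,\mathrm{Im}(Z)^{-1}$ (for the action $S\cdot Z=Z+S$). For a moment map $\mu^H$ on a domain $D$, a $\mu^H$-symbol is an $a\in L^\infty(D)$ that can be written (a.e.) as $a=f\circ\mu^H$ for some measurable function $f$. *)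

theory Defs
  imports "HOL-Analysis.Analysis"
begin

section \<open>Symmetric matrices and the two domains\<close>

definition Symm :: "('a ^ 'n ^ 'n) set" where
  "Symm = {Z. transpose Z = Z}"

definition pos_def_complex :: "complex ^ 'n ^ 'n \<Rightarrow> bool" where
  "pos_def_complex A \<longleftrightarrow> map_matrix cnj (transpose A) = A \<and>
     (\<forall>v. v \<noteq> 0 \<longrightarrow> 0 < Re (\<Sum>i\<in>UNIV. cnj (v $ i) * (A *v v) $ i))"

definition pos_def_real :: "real ^ 'n ^ 'n \<Rightarrow> bool" where
  "pos_def_real A \<longleftrightarrow> transpose A = A \<and> (\<forall>v. v \<noteq> 0 \<longrightarrow> 0 < v \<bullet> (A *v v))"

definition D_III :: "(complex ^ 'n ^ 'n) set" where
  "D_III = {Z \<in> Symm. pos_def_complex (mat 1 - Z ** map_matrix cnj Z)}"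

definition Siegel :: "(complex ^ 'n ^ 'n) set" where
  "Siegel = {Z \<in> Symm. pos_def_real (map_matrix Im Z)}"


section \<open>Lebesgue measure on the space of complex symmetric matrices\<close>

text \<open>
  The symmetric matrices are a null set for the Lebesgue measure of the space of all matrices, so
  they carry their own measure: the entries \<open>Z $ i $ j\<close>, one for each unordered pair
  \<open>{i, j}\<close> (with \<open>i = j\<close> allowed), are independent linear coordinates, and the measure is
  the product of the Lebesgue measures in these coordinates.
\<close>

definition Symm_of_coords :: "('n set \<Rightarrow> 'a) \<Rightarrow> 'a ^ 'n ^ 'n" where
  "Symm_of_coords w = (\<chi> i j. w {i, j})"

definition lborel_Symm :: "(complex ^ 'n ^ 'n) measure" where
  "lborel_Symm = distr (\<Pi>\<^sub>M s\<in>{{i, j} | i j. True}. lborel) (restrict_space borel Symm) Symm_of_coords"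

definition lebesgue_Symm_on :: "(complex ^ 'n ^ 'n) set \<Rightarrow> (complex ^ 'n ^ 'n) measure" where
  "lebesgue_Symm_on D = restrict_space (completion lborel_Symm) D"


section \<open>Bounded functions, moment maps and symbols\<close>

text \<open>Functions representing the elements of \<open>L\<^sup>\<infinity>\<close>; no quotient by almost everywhere equality.\<close>

definition Linfty :: "'a measure \<Rightarrow> ('a \<Rightarrow> complex) set" where
  "Linfty M = {a \<in> borel_measurable M. \<exists>C. AE x in M. norm (a x) \<le> C}"

text \<open>The trace is real on \<open>D_III\<close>, see \<open>Im_trace_D_III\<close> below; \<open>Re\<close> only changes its type.\<close>

definition mu_T :: "complex ^ 'n ^ 'n \<Rightarrow> real" where
  "mu_T Z = - 2 * Re (trace (matrix_inv (mat 1 - Z ** map_matrix cnj Z)))"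

definition mu_Rplus :: "complex ^ 'n ^ 'n \<Rightarrow> real" where
  "mu_Rplus Z = - 4 * trace (matrix_inv (map_matrix Im Z) ** map_matrix Re Z)"

definition mu_Symm :: "complex ^ 'n ^ 'n \<Rightarrow> real ^ 'n ^ 'n" where
  "mu_Symm Z = - 2 *\<^sub>R matrix_inv (map_matrix Im Z)"

text \<open>
  \<open>M\<close> is the measure on the domain, \<open>N\<close> the codomain of the moment map \<open>\<mu>\<close>
  with its Borel structure.
\<close>

definition moment_symbol ::
  "'a measure \<Rightarrow> 'b measure \<Rightarrow> ('a \<Rightarrow> 'b) \<Rightarrow> ('a \<Rightarrow> complex) \<Rightarrow> bool" where
  "moment_symbol M N \<mu> a \<longleftrightarrow>
     a \<in> Linfty M \<and> (\<exists>f\<in>borel_measurable N. AE Z in M. a Z = (f \<circ> \<mu>) Z)"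


section \<open>Well-definedness\<close>

lemma pos_def_complex_invertible:
  fixes A :: "complex ^ 'n ^ 'n"
  assumes "pos_def_complex A" shows "invertible A"
proof -
  have "v = 0" if "A *v v = 0" for v
  proof (rule ccontr)
    assume "v \<noteq> 0"
    then have "0 < Re (\<Sum>i\<in>UNIV. cnj (v $ i) * (A *v v) $ i)"
      using assms unfolding pos_def_complex_def by blast
    then show False using that by simp
  qed
  then show ?thesis
    by (metis invertible_left_inverse matrix_left_invertible_ker)
qed

lemma pos_def_real_invertible:
  fixes A :: "real ^ 'n ^ 'n"
  assumes "pos_def_real A" shows "invertible A"
proof -
  have "v = 0" if "A *v v = 0" for v
    using assms that unfolding pos_def_real_def by (metis inner_zero_right less_irrefl)
  then show ?thesis
    by (metis invertible_left_inverse matrix_left_invertible_ker)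
qed

lemma invertible_matrix_inv_right:
  fixes A :: "'a::field ^ 'n ^ 'n"
  assumes "invertible A" shows "A ** matrix_inv A = mat 1"
  using someI_ex[OF assms[unfolded invertible_def]] by (simp add: matrix_inv_def)

lemma matrix_inv_unique_left:
  fixes A B :: "'a::field ^ 'n ^ 'n"
  assumes "invertible A" "B ** A = mat 1" shows "B = matrix_inv A"
proof -
  have "B = B ** (A ** matrix_inv A)" using assms by (simp add: invertible_matrix_inv_right)
  also have "\<dots> = matrix_inv A" using assms by (simp add: matrix_mul_assoc)
  finally show ?thesis .
qed

lemma Im_trace_D_III:
  fixes Z :: "complex ^ 'n ^ 'n"
  assumes "Z \<in> D_III"
  shows "Im (trace (matrix_inv (mat 1 - Z ** map_matrix cnj Z))) = 0"
proof -
  define A where "A = mat 1 - Z ** map_matrix cnj Z"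
  define B where "B = matrix_inv A"
  have pd: "pos_def_complex A" using assms by (simp add: D_III_def A_def)
  have inv: "invertible A" by (rule pos_def_complex_invertible[OF pd])
  have herm: "map_matrix cnj (transpose A) = A" using pd by (simp add: pos_def_complex_def)
  have AB: "A ** B = mat 1" using inv by (simp add: B_def invertible_matrix_inv_right)
  have "map_matrix cnj (transpose (A ** B))
      = map_matrix cnj (transpose B) ** map_matrix cnj (transpose A)"
    by (simp add: vec_eq_iff transpose_def matrix_matrix_mult_def mult.commute)
  moreover have "map_matrix cnj (transpose (mat 1 :: complex ^ 'n ^ 'n)) = mat 1"
    by (simp add: vec_eq_iff mat_def transpose_def)
  ultimately have "map_matrix cnj (transpose B) ** A = mat 1" using AB herm by simp
  then have "map_matrix cnj (transpose B) = B"
    using matrix_inv_unique_left[OF inv] B_def by blast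
  then have "map_matrix cnj (transpose B) $ i $ i = B $ i $ i" for i by simp
  then have "cnj (B $ i $ i) = B $ i $ i" for i by (simp add: transpose_def)
  then have "cnj (trace B) = trace B" by (simp add: trace_def)
  then show ?thesis by (simp add: A_def B_def complex_eq_iff)
qed

lemma mu_Symm_in_Symm:
  fixes Z :: "complex ^ 'n ^ 'n"
  assumes "Z \<in> Siegel" shows "mu_Symm Z \<in> Symm"
proof -
  define A where "A = map_matrix Im Z"
  have pd: "pos_def_real A" using assms by (simp add: Siegel_def A_def)
  have inv: "invertible A" by (rule pos_def_real_invertible[OF pd])
  have sym: "transpose A = A" using pd by (simp add: pos_def_real_def)
  have "transpose (A ** matrix_inv A) = transpose (mat 1)"
    using inv by (simp add: invertible_matrix_inv_right)
  then have "transpose (matrix_inv A) ** A = mat 1"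
    by (simp add: matrix_transpose_mul sym)
  then have "transpose (matrix_inv A) = matrix_inv A"
    by (rule matrix_inv_unique_left[OF inv])
  then have "transpose (matrix_inv A) $ i $ j = matrix_inv A $ i $ j" for i j by simp
  then have "matrix_inv A $ j $ i = matrix_inv A $ i $ j" for i j by (simp add: transpose_def)
  then show ?thesis
    by (simp add: mu_Symm_def Symm_def A_def transpose_def vec_eq_iff)
qed

lemma measurable_Symm_of_coords:
  "(Symm_of_coords :: _ \<Rightarrow> complex ^ 'n ^ 'n)
     \<in> (\<Pi>\<^sub>M s\<in>{{i, j} | i j. True}. lborel) \<rightarrow>\<^sub>M restrict_space borel Symm"
proof (rule measurable_restrict_space2)
  show "Symm_of_coords \<in> space (\<Pi>\<^sub>M s\<in>{{i, j} | i j. True}. lborel) \<rightarrow> (Symm :: (complex ^ 'n ^ 'n) set)"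
    by (auto simp: Symm_of_coords_def Symm_def transpose_def vec_eq_iff insert_commute)
  have "(\<lambda>w. Symm_of_coords w \<bullet> axis i (axis j b))
      \<in> borel_measurable (\<Pi>\<^sub>M s\<in>{{i, j} | i j. True}. (lborel :: complex measure))" for i j :: 'n and b
  proof -
    have "(\<lambda>w. w {i, j}) \<in> (\<Pi>\<^sub>M s\<in>{{i, j} | i j. True}. (lborel :: complex measure)) \<rightarrow>\<^sub>M lborel"
      by (rule measurable_component_singleton) blast
    then have "(\<lambda>w. w {i, j}) \<in> borel_measurable (\<Pi>\<^sub>M s\<in>{{i, j} | i j. True}. (lborel :: complex measure))"
      by simp
    then show ?thesis
      by (simp add: Symm_of_coords_def inner_axis)
  qed
  then show "(Symm_of_coords :: _ \<Rightarrow> complex ^ 'n ^ 'n)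
      \<in> borel_measurable (\<Pi>\<^sub>M s\<in>{{i, j} | i j. True}. lborel)"
    by (subst borel_measurable_euclidean_space) (auto simp: Basis_vec_def)
qed

lemma open_pos_form:
  fixes F :: "'v::euclidean_space \<Rightarrow> 'z::euclidean_space \<Rightarrow> real"
  assumes cont: "continuous_on UNIV (\<lambda>(v, z). F v z)"
    and hom: "\<And>c v z. F (c *\<^sub>R v) z = c\<^sup>2 * F v z"
  shows "open {z. \<forall>v. v \<noteq> 0 \<longrightarrow> 0 < F v z}"
proof -
  have "closed {p. (\<lambda>(v, z). F v z) p \<le> 0}"
    by (intro closed_Collect_le cont continuous_on_const)
  then have "closed {z. \<exists>v. v \<in> sphere 0 1 \<and> (v, z) \<in> {p. (\<lambda>(v, z). F v z) p \<le> 0}}"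
    by (intro closed_compact_projection compact_sphere)
  moreover have "- {z. \<forall>v. v \<noteq> 0 \<longrightarrow> 0 < F v z}
      = {z. \<exists>v. v \<in> sphere 0 1 \<and> (v, z) \<in> {p. (\<lambda>(v, z). F v z) p \<le> 0}}"
  proof (intro set_eqI iffI)
    fix z assume "z \<in> - {z. \<forall>v. v \<noteq> 0 \<longrightarrow> 0 < F v z}"
    then obtain v where v: "v \<noteq> 0" "F v z \<le> 0" by force
    have "F ((1 / norm v) *\<^sub>R v) z \<le> 0"
      using v by (subst hom) (simp add: mult_nonneg_nonpos)
    moreover have "(1 / norm v) *\<^sub>R v \<in> sphere 0 1" using v by simp
    ultimately show "z \<in> {z. \<exists>v. v \<in> sphere 0 1 \<and> (v, z) \<in> {p. (\<lambda>(v, z). F v z) p \<le> 0}}"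
      unfolding mem_Collect_eq prod.case by (intro exI conjI)
  next
    fix z assume "z \<in> {z. \<exists>v. v \<in> sphere 0 1 \<and> (v, z) \<in> {p. (\<lambda>(v, z). F v z) p \<le> 0}}"
    then obtain v where v: "norm v = 1" "F v z \<le> 0" by auto
    then have "v \<noteq> 0" by auto
    then show "z \<in> - {z. \<forall>v. v \<noteq> 0 \<longrightarrow> 0 < F v z}" using v by force
  qed
  ultimately show ?thesis by (simp add: open_closed)
qed

lemma D_III_eq_open_Int:
  "\<exists>U. open U \<and> (D_III :: (complex ^ 'n ^ 'n) set) = Symm \<inter> U"
proof -
  define F where "F = (\<lambda>(v :: complex ^ 'n) (Z :: complex ^ 'n ^ 'n).
    Re (\<Sum>i\<in>UNIV. cnj (v $ i) * ((mat 1 - Z ** map_matrix cnj Z) *v v) $ i))"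
  have "open {Z. \<forall>v. v \<noteq> 0 \<longrightarrow> 0 < F v Z}"
  proof (rule open_pos_form)
    show "continuous_on UNIV (\<lambda>(v, Z). F v Z)"
      unfolding F_def case_prod_beta matrix_vector_mult_def matrix_matrix_mult_def map_matrix_def
      by (simp add: mat_def) (intro continuous_intros)
    show "F (c *\<^sub>R v) Z = c\<^sup>2 * F v Z" for c v Z
    proof -
      define A where "A = mat 1 - Z ** map_matrix cnj Z"
      have "(A *v (c *\<^sub>R v)) $ i = of_real c * (A *v v) $ i" for i
        unfolding matrix_vector_mult_def vector_scaleR_component vec_lambda_beta
        by (simp add: sum_distrib_left scaleR_conv_of_real mult.left_commute)
      then have "cnj ((c *\<^sub>R v) $ i) * (A *v (c *\<^sub>R v)) $ i
          = of_real (c\<^sup>2) * (cnj (v $ i) * (A *v v) $ i)" for i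
        by (simp only: vector_scaleR_component)
          (simp add: scaleR_conv_of_real power2_eq_square mult_ac)
      then have "(\<Sum>i\<in>UNIV. cnj ((c *\<^sub>R v) $ i) * (A *v (c *\<^sub>R v)) $ i)
          = of_real (c\<^sup>2) * (\<Sum>i\<in>UNIV. cnj (v $ i) * (A *v v) $ i)"
        by (simp only: sum_distrib_left)
      then show ?thesis unfolding F_def A_def[symmetric]
        by (simp only: times_complex.sel complex.sel Re_complex_of_real Im_complex_of_real)
    qed
  qed
  moreover have "map_matrix cnj (transpose (mat 1 - Z ** map_matrix cnj Z))
      = mat 1 - Z ** map_matrix cnj Z" if "Z \<in> Symm" for Z :: "complex ^ 'n ^ 'n"
  proof -
    have "transpose Z $ i $ j = Z $ i $ j" for i j using that by (simp add: Symm_def)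
    then have "Z $ j $ i = Z $ i $ j" for i j by (simp add: transpose_def)
    then show ?thesis
      by (simp add: vec_eq_iff transpose_def mat_def matrix_matrix_mult_def mult.commute)
  qed
  then have "(D_III :: (complex ^ 'n ^ 'n) set) = Symm \<inter> {Z. \<forall>v. v \<noteq> 0 \<longrightarrow> 0 < F v Z}"
    by (auto simp: D_III_def pos_def_complex_def F_def)
  ultimately show ?thesis by blast
qed

lemma Siegel_eq_open_Int:
  "\<exists>U. open U \<and> (Siegel :: (complex ^ 'n ^ 'n) set) = Symm \<inter> U"
proof -
  define F where "F = (\<lambda>(v :: real ^ 'n) (Z :: complex ^ 'n ^ 'n). v \<bullet> (map_matrix Im Z *v v))"
  have "open {Z. \<forall>v. v \<noteq> 0 \<longrightarrow> 0 < F v Z}"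
  proof (rule open_pos_form)
    show "continuous_on UNIV (\<lambda>(v, Z). F v Z)"
      unfolding F_def case_prod_beta matrix_vector_mult_def map_matrix_def
      by simp (intro continuous_intros)
    show "F (c *\<^sub>R v) Z = c\<^sup>2 * F v Z" for c v Z
      unfolding F_def
      by (simp add: matrix_vector_mult_scaleR power2_eq_square)
  qed
  moreover have "transpose (map_matrix Im Z) = map_matrix Im Z" if "Z \<in> Symm" for Z :: "complex ^ 'n ^ 'n"
  proof -
    have "transpose Z $ i $ j = Z $ i $ j" for i j using that by (simp add: Symm_def)
    then have "Z $ j $ i = Z $ i $ j" for i j by (simp add: transpose_def)
    then show ?thesis by (simp add: vec_eq_iff transpose_def)
  qed
  then have "(Siegel :: (complex ^ 'n ^ 'n) set) = Symm \<inter> {Z. \<forall>v. v \<noteq> 0 \<longrightarrow> 0 < F v Z}"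
    by (auto simp: Siegel_def pos_def_real_def F_def)
  ultimately show ?thesis by blast
qed

lemma domains_in_sets:
  "(D_III :: (complex ^ 'n ^ 'n) set) \<in> sets (lborel_Symm)"
  "(Siegel :: (complex ^ 'n ^ 'n) set) \<in> sets (lborel_Symm)"
  using D_III_eq_open_Int[where 'n = 'n] Siegel_eq_open_Int[where 'n = 'n]
  by (auto simp: lborel_Symm_def sets_restrict_space)

end

theory Submission
  imports Defs
begin

text \<open>
  Each moment map and the corresponding function on the right-hand side determine each other
  through a Borel map: a rescaling of \<open>\<real>\<close> for the first two, and the involution
  \<open>Y \<mapsto> - 2 Y\<^sup>-\<^sup>1\<close>, measurable by Cramer's rule, for the third. Composition
  with these maps translates the symbols into each other.
\<close>

text \<open>If \<open>a\<close> is almost everywhere \<open>f\<close> after \<open>\<mu>\<close>, it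
  is \<open>f \<circ> \<psi>\<close> after \<open>\<nu>\<close>, and conversely with
  \<open>\<phi>\<close>. The two relations are asked for only on \<open>space M\<close>, because
  \<open>matrix_inv\<close> inverts only where the matrix is invertible, as it is on the
  domains.\<close>

lemma moment_symbol_iff_of_measurable_change:
  assumes a: "a \<in> Linfty M"
    and meas: "\<phi> \<in> N \<rightarrow>\<^sub>M N'" "\<psi> \<in> N' \<rightarrow>\<^sub>M N"
    and eq: "\<And>x. x \<in> space M \<Longrightarrow> \<nu> x = \<phi> (\<mu> x)" "\<And>x. x \<in> space M \<Longrightarrow> \<mu> x = \<psi> (\<nu> x)"
  shows "moment_symbol M N \<mu> a \<longleftrightarrow> (\<exists>f. f \<in> borel_measurable N' \<and> (AE x in M. a x = f (\<nu> x)))"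
proof
  assume "moment_symbol M N \<mu> a"
  then obtain f where f: "f \<in> borel_measurable N" "AE x in M. a x = f (\<mu> x)"
    by (auto simp: moment_symbol_def)
  have "AE x in M. a x = (f \<circ> \<psi>) (\<nu> x)"
    using f(2) AE_space by eventually_elim (simp add: eq(2)[symmetric])
  moreover have "f \<circ> \<psi> \<in> borel_measurable N'"
    by (rule measurable_comp[OF meas(2) f(1)])
  ultimately show "\<exists>f. f \<in> borel_measurable N' \<and> (AE x in M. a x = f (\<nu> x))" by blast
next
  assume "\<exists>f. f \<in> borel_measurable N' \<and> (AE x in M. a x = f (\<nu> x))"
  then obtain f where f: "f \<in> borel_measurable N'" "AE x in M. a x = f (\<nu> x)" by blast
  have "AE x in M. a x = ((f \<circ> \<phi>) \<circ> \<mu>) x"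
    using f(2) AE_space by eventually_elim (simp add: eq(1)[symmetric])
  moreover have "f \<circ> \<phi> \<in> borel_measurable N"
    by (rule measurable_comp[OF meas(1) f(1)])
  ultimately show "moment_symbol M N \<mu> a"
    using a unfolding moment_symbol_def by blast
qed

text \<open>Column \<open>j\<close> of the inverse solves \<open>A *v x = axis j 1\<close>, so
  Cramer's rule gives its entries. As quotients of determinants they are visibly Borel functions of
  the entries of \<open>A\<close>, unlike the choice operator behind
  \<open>matrix_inv\<close>.\<close>

lemma matrix_inv_eq_cramer:
  fixes A :: "'a::field ^ 'n ^ 'n"
  assumes "invertible A"
  shows "matrix_inv A = (\<chi> k j. det (\<chi> i l. if l = k then axis j 1 $ i else A $ i $ l) / det A)"
proof -
  have "column j (matrix_inv A)
      = (\<chi> k. det (\<chi> i l. if l = k then axis j 1 $ i else A $ i $ l) / det A)" for j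
  proof (subst cramer[symmetric])
    show "det A \<noteq> 0" using assms by (simp add: invertible_det_nz)
    have "A *v (matrix_inv A *v axis j 1) = axis j 1"
      by (simp add: matrix_vector_mul_assoc invertible_matrix_inv_right[OF assms])
    moreover have "matrix_inv A *v axis j 1 = column j (matrix_inv A)"
      by (simp add: vec_eq_iff column_def matrix_vector_mult_def axis_def if_distrib cong: if_cong)
    ultimately show "A *v column j (matrix_inv A) = axis j 1" by simp
  qed
  then show ?thesis by (simp add: vec_eq_iff column_def)
qed

text \<open>The inner products with the standard basis of the matrix space are exactly the
  entries.\<close>

lemma borel_measurable_matrix_entries:
  fixes f :: "'b \<Rightarrow> real ^ 'n ^ 'm"
  assumes "\<And>i j. (\<lambda>x. f x $ i $ j) \<in> borel_measurable M"
  shows "f \<in> borel_measurable M"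
  by (subst borel_measurable_euclidean_space) (auto simp: Basis_vec_def inner_axis assms)

lemma borel_measurable_det:
  fixes f :: "'b \<Rightarrow> real ^ 'n ^ 'n"
  assumes "\<And>i j. (\<lambda>x. f x $ i $ j) \<in> borel_measurable M"
  shows "(\<lambda>x. det (f x)) \<in> borel_measurable M"
  unfolding det_def by (intro borel_measurable_sum borel_measurable_times borel_measurable_prod
      borel_measurable_const assms)

lemma borel_measurable_matrix_entry:
  "(\<lambda>A :: real ^ 'n ^ 'm. A $ i $ j) \<in> borel_measurable borel"
  by (intro borel_measurable_continuous_onI continuous_intros)

text \<open>The value 0 at singular matrices is chosen to agree with Cramer's formula, where
  division by \<open>det A = 0\<close> yields 0, and to stay inside \<open>Symm\<close>.\<close>

definition neg_two_inv :: "real ^ 'n ^ 'n \<Rightarrow> real ^ 'n ^ 'n" where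
  "neg_two_inv A = (if invertible A then - 2 *\<^sub>R matrix_inv A else 0)"

lemma borel_measurable_neg_two_inv:
  "(neg_two_inv :: real ^ 'n ^ 'n \<Rightarrow> _) \<in> borel_measurable borel"
proof -
  define c where "c = (\<lambda>A :: real ^ 'n ^ 'n.
    \<chi> k j. det (\<chi> i l. if l = k then axis j 1 $ i else A $ i $ l) / det A)"
  \<comment> \<open>This holds at every matrix, singular ones included, so no case split on
    invertibility enters the measurability argument.\<close>
  have eq: "neg_two_inv = (\<lambda>A :: real ^ 'n ^ 'n. - 2 *\<^sub>R c A)"
    by (auto simp: neg_two_inv_def c_def matrix_inv_eq_cramer invertible_det_nz vec_eq_iff)
  have "(\<lambda>A. c A $ k $ j) \<in> borel_measurable borel" for k j
    unfolding c_def vec_lambda_beta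
    \<comment> \<open>Each entry of the modified matrix is either a constant or an entry of
      \<open>A\<close>; the condition \<open>l = k\<close> choosing between them does not depend on
      \<open>A\<close>.\<close>
    by (intro borel_measurable_divide borel_measurable_det, subst vec_lambda_beta,
        subst vec_lambda_beta, rule measurable_If)
      (simp_all add: borel_measurable_matrix_entry)
  then have "c \<in> borel_measurable borel"
    by (rule borel_measurable_matrix_entries)
  then have "(\<lambda>A. - 2 *\<^sub>R c A) \<in> borel_measurable borel"
    by (intro borel_measurable_scaleR borel_measurable_const)
  then show ?thesis unfolding eq .
qed

lemma transpose_matrix_inv:
  fixes A :: "'a::field ^ 'n ^ 'n"
  assumes "invertible A" "transpose A = A"
  shows "transpose (matrix_inv A) = matrix_inv A"
proof (rule matrix_inv_unique_left[OF assms(1)])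
  have "transpose (A ** matrix_inv A) = mat 1"
    using assms(1) by (simp add: invertible_matrix_inv_right)
  then show "transpose (matrix_inv A) ** A = mat 1"
    by (simp add: matrix_transpose_mul assms(2))
qed

text \<open>Inverses of symmetric matrices are symmetric, and so is the default value 0. This lets
  the map act on the codomain \<open>restrict_space borel Symm\<close> of the third moment
  map.\<close>

lemma neg_two_inv_in_Symm:
  assumes "A \<in> Symm" shows "neg_two_inv A \<in> Symm"
proof (cases "invertible A")
  case True
  then have "transpose (matrix_inv A) = matrix_inv A"
    using assms by (simp add: Symm_def transpose_matrix_inv)
  then show ?thesis
    using True by (simp add: neg_two_inv_def Symm_def transpose_def vec_eq_iff)
qed (simp add: neg_two_inv_def Symm_def transpose_def vec_eq_iff)

lemma matrix_mul_scaleR: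
  fixes A :: "real ^ 'n ^ 'm" and B :: "real ^ 'k ^ 'n"
  shows "(c *\<^sub>R A) ** (d *\<^sub>R B) = (c * d) *\<^sub>R (A ** B)"
  by (simp add: matrix_matrix_mult_def vec_eq_iff sum_distrib_left mult_ac)

lemma neg_two_inv_involution:
  assumes "invertible A" shows "neg_two_inv (neg_two_inv A) = A"
proof -
  define B where "B = - 2 *\<^sub>R matrix_inv A"
  \<comment> \<open>The left inverse \<open>- A / 2\<close> of \<open>B\<close> is its inverse, and
    multiplying it by \<open>- 2\<close> gives back \<open>A\<close>.\<close>
  have AB: "((- 1 / 2) *\<^sub>R A) ** B = mat 1"
    unfolding B_def matrix_mul_scaleR invertible_matrix_inv_right[OF assms] by simp
  then have B: "invertible B"
    by (auto simp: invertible_left_inverse)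
  have "- 2 *\<^sub>R matrix_inv B = A"
    unfolding matrix_inv_unique_left[OF B AB, symmetric] by simp
  then show ?thesis using assms B by (simp add: neg_two_inv_def B_def)
qed

lemma measurable_neg_two_inv_Symm:
  "neg_two_inv \<in> restrict_space borel Symm \<rightarrow>\<^sub>M restrict_space borel Symm"
  by (intro measurable_restrict_space2 measurable_restrict_space1 borel_measurable_neg_two_inv)
    (auto simp: space_restrict_space neg_two_inv_in_Symm)

theorem proposition5p4:
  fixes a b :: "complex ^ 'n ^ 'n \<Rightarrow> complex"
  assumes "a \<in> Linfty (lebesgue_Symm_on D_III)"
    and "b \<in> Linfty (lebesgue_Symm_on Siegel)"
  shows "(moment_symbol (lebesgue_Symm_on D_III) borel mu_T a \<longleftrightarrow>
           (\<exists>f :: real \<Rightarrow> complex. f \<in> borel_measurable borel \<and>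
             (AE Z in lebesgue_Symm_on D_III.
                a Z = f (Re (trace (matrix_inv (mat 1 - Z ** map_matrix cnj Z))))))) \<and>
    (moment_symbol (lebesgue_Symm_on Siegel) borel mu_Rplus b \<longleftrightarrow>
           (\<exists>f :: real \<Rightarrow> complex. f \<in> borel_measurable borel \<and>
             (AE Z in lebesgue_Symm_on Siegel.
                b Z = f (trace (matrix_inv (map_matrix Im Z) ** map_matrix Re Z))))) \<and>
    (moment_symbol (lebesgue_Symm_on Siegel) (restrict_space borel Symm) mu_Symm b \<longleftrightarrow>
           (\<exists>f :: real ^ 'n ^ 'n \<Rightarrow> complex. f \<in> borel_measurable (restrict_space borel Symm) \<and>
             (AE Z in lebesgue_Symm_on Siegel. b Z = f (map_matrix Im Z))))"
proof (intro conjI)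
  show "moment_symbol (lebesgue_Symm_on D_III) borel mu_T a \<longleftrightarrow>
      (\<exists>f :: real \<Rightarrow> complex. f \<in> borel_measurable borel \<and> (AE Z in lebesgue_Symm_on D_III.
        a Z = f (Re (trace (matrix_inv (mat 1 - Z ** map_matrix cnj Z))))))"
    by (rule moment_symbol_iff_of_measurable_change[OF assms(1),
          where \<phi> = "\<lambda>t. t / (- 2)" and \<psi> = "\<lambda>t. - 2 * t"])
      (auto simp: mu_T_def)
  show "moment_symbol (lebesgue_Symm_on Siegel) borel mu_Rplus b \<longleftrightarrow>
      (\<exists>f :: real \<Rightarrow> complex. f \<in> borel_measurable borel \<and> (AE Z in lebesgue_Symm_on Siegel.
        b Z = f (trace (matrix_inv (map_matrix Im Z) ** map_matrix Re Z))))"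
    by (rule moment_symbol_iff_of_measurable_change[OF assms(2),
          where \<phi> = "\<lambda>t. t / (- 4)" and \<psi> = "\<lambda>t. - 4 * t"])
      (auto simp: mu_Rplus_def)
  \<comment> \<open>Positive definiteness of the imaginary part keeps \<open>neg_two_inv\<close>
    away from its default value on the Siegel domain.\<close>
  have "invertible (map_matrix Im Z)" if "Z \<in> space (lebesgue_Symm_on Siegel)"
    for Z :: "complex ^ 'n ^ 'n"
    using that by (auto simp: lebesgue_Symm_on_def space_restrict_space Siegel_def
        intro: pos_def_real_invertible)
  then have mu: "mu_Symm Z = neg_two_inv (map_matrix Im Z)"
      "map_matrix Im Z = neg_two_inv (mu_Symm Z)"
    if "Z \<in> space (lebesgue_Symm_on Siegel)" for Z :: "complex ^ 'n ^ 'n"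
    using that neg_two_inv_involution[of "map_matrix Im Z"]
    by (simp_all add: mu_Symm_def neg_two_inv_def)
  show "moment_symbol (lebesgue_Symm_on Siegel) (restrict_space borel Symm) mu_Symm b \<longleftrightarrow>
      (\<exists>f :: real ^ 'n ^ 'n \<Rightarrow> complex. f \<in> borel_measurable (restrict_space borel Symm) \<and>
        (AE Z in lebesgue_Symm_on Siegel. b Z = f (map_matrix Im Z)))"
    \<comment> \<open>Since \<open>neg_two_inv\<close> is an involution on invertible matrices, it
      serves as both \<phi> and \<psi>.\<close>
    by (rule moment_symbol_iff_of_measurable_change[OF assms(2)
          measurable_neg_two_inv_Symm measurable_neg_two_inv_Symm mu(2) mu(1)])
qed

end
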